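(* Let $B_2=\{312,321,1342\}$. For every positive integer $n$ and every nonnegative integer $k$, the number of permutations in $\operatorname{Av}_n(B_2)$ with exactly $k$ inversions is $$\sum_{\ell=1}^{n}\binom{n-k-1}{k-\ell+1}.$$
   Context: $\operatorname{Av}_n(S)$ is the set of permutations of length $n$ avoiding every pattern in $S$ (classical pattern avoidance). An inversion of a permutation $\pi$ is a pair of positions $i<j$ with $\pi_i>\pi_j$. Binomial coefficients $\binom{a}{b}$ with integer arguments are taken to be $0$ unless $0\le b\le a$. *)

theory Defs
  imports "HOL-Combinatorics.Multiset_Permutations" "HOL-Library.Sublist"
begin

(* Permutations of length n and patterns are given in one-line notation, as lists over
   the values 1..n.  Positions in lists are counted from 0, the values start at 1. *)

definition order_isomorphic :: "nat list \<Rightarrow> nat list \<Rightarrow> bool" where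
  "order_isomorphic xs ys \<longleftrightarrow> length xs = length ys \<and>
     (\<forall>i<length xs. \<forall>j<length xs. xs ! i < xs ! j \<longleftrightarrow> ys ! i < ys ! j)"

(* Entries of an occurrence need not be adjacent: subseq is the scattered sublist relation. *)
definition contains_pattern :: "nat list \<Rightarrow> nat list \<Rightarrow> bool" where
  "contains_pattern \<pi> \<sigma> \<longleftrightarrow> (\<exists>xs. subseq xs \<pi> \<and> order_isomorphic xs \<sigma>)"

definition Av :: "nat \<Rightarrow> nat list set \<Rightarrow> nat list set" where
  "Av n S = {\<pi> \<in> permutations_of_set {1..n}. \<forall>\<sigma>\<in>S. \<not> contains_pattern \<pi> \<sigma>}"

definition inversions :: "nat list \<Rightarrow> (nat \<times> nat) set" where
  "inversions \<pi> = {(i, j). i < j \<and> j < length \<pi> \<and> \<pi> ! i > \<pi> ! j}"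

definition B2 :: "nat list set" where
  "B2 = {[3,1,2], [3,2,1], [1,3,4,2]}"

(* The arguments are integers so that differences are not truncated: a negative upper or
   lower argument gives 0. *)
definition int_binomial :: "int \<Rightarrow> int \<Rightarrow> nat" where
  "int_binomial a b = (if 0 \<le> b \<and> b \<le> a then nat a choose nat b else 0)"

end

theory Submission
  imports Defs
begin

text \<open>
  Avoiding 312 and 321 leaves room for at most one entry after the maximum \<open>n\<close>. If \<open>n\<close> is
  followed by some \<open>x < n - 1\<close>, then \<open>n - 1\<close> stands directly before \<open>n\<close>, so avoiding 1342 forces
  \<open>x = 1\<close>, and avoiding 321 leaves only \<open>2 3 \<dots> n 1\<close>. Hence every permutation of length \<open>n \<ge> 2\<close>
  arises uniquely from a shorter nonempty one by appending \<open>n\<close> or \<open>n, n - 1\<close>, which adds 0 or 1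
  inversions, or is this rotation, which has \<open>n - 1\<close> inversions. Pascal's rule gives the same
  recurrence for the sum of binomial coefficients.
\<close>

section \<open>Subsequences seen from the right end\<close>

text \<open>Permutations grow at the right end below, so patterns have to be peeled there. If the
  last letters agree, they may be matched with each other; otherwise \<open>y\<close> cannot be used
  at all.\<close>

lemma subseq_snoc_iff:
  "subseq (xs @ [x]) (ys @ [y]) \<longleftrightarrow> (if x = y then subseq xs ys else subseq (xs @ [x]) ys)"
proof (cases "x = y")
  case True
  then show ?thesis by simp
next
  case False
  then show ?thesis
  proof (induction ys arbitrary: xs)
    case Nil
    then show ?case by (cases xs) auto
  next
    case (Cons z zs)
    \<comment> \<open>If the head of \<open>xs\<close> matches \<open>z\<close>, the tail is left to
      embed; otherwise all of \<open>xs\<close> is.\<close>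
    then show ?case
      using Cons.IH[of xs] Cons.IH[of "tl xs"] by (cases xs) auto
  qed
qed

lemma subseq3_snoc_iff:
  "subseq [a, b, c] (ys @ [y]) \<longleftrightarrow> (if c = y then subseq [a, b] ys else subseq [a, b, c] ys)"
  using subseq_snoc_iff[of "[a, b]" c ys y] by simp

lemma subseq4_snoc_iff:
  "subseq [a, b, c, d] (ys @ [y]) \<longleftrightarrow>
    (if d = y then subseq [a, b, c] ys else subseq [a, b, c, d] ys)"
  using subseq_snoc_iff[of "[a, b, c]" d ys y] by simp

lemma subseq_set: "subseq xs ys \<Longrightarrow> set xs \<subseteq> set ys"
  by (auto elim: list_emb_set)

lemma subseq_distinct: "subseq xs ys \<Longrightarrow> distinct ys \<Longrightarrow> distinct xs"
  by (metis distinct_nthsI subseq_conv_nths)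

lemma sorted_if_subseq_le:
  "(\<And>a b. subseq [a, b] xs \<Longrightarrow> a \<le> b) \<Longrightarrow> sorted xs"
proof (induction xs)
  case (Cons x xs)
  have "x \<le> y" if "y \<in> set xs" for y
    using that Cons.prems[of x y] by (simp add: subseq_singleton_left)
  moreover have "sorted xs"
    using Cons by (meson list_emb_Cons)
  ultimately show ?case by simp
qed simp

lemma subseq_Cons_append:
  "subseq xs zs \<Longrightarrow> subseq (x # xs) (ys @ x # zs)"
  by (simp add: list_emb_append2)

section \<open>Pattern containment as inequalities\<close>

text \<open>One chain of inequalities decides every comparison between positions, so order
  isomorphism to a fixed pattern says no more than that chain. The other two patterns work
  likewise.\<close>

lemma contains_pattern_312:
  "contains_pattern \<pi> [3,1,2] \<longleftrightarrow> (\<exists>a b c. subseq [a, b, c] \<pi> \<and> b < c \<and> c < a)"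
proof
  assume "contains_pattern \<pi> [3,1,2]"
  then obtain xs where xs: "subseq xs \<pi>" "order_isomorphic xs [3,1,2]"
    by (auto simp: contains_pattern_def)
  then obtain a b c where "xs = [a, b, c]"
    by (auto simp: order_isomorphic_def length_Suc_conv)
  with xs show "\<exists>a b c. subseq [a, b, c] \<pi> \<and> b < c \<and> c < a"
    by (fastforce simp: order_isomorphic_def All_less_Suc2)
next
  assume "\<exists>a b c. subseq [a, b, c] \<pi> \<and> b < c \<and> c < a"
  then obtain a b c where "subseq [a, b, c] \<pi>" "b < c" "c < a"
    by blast
  then show "contains_pattern \<pi> [3,1,2]"
    unfolding contains_pattern_def
    by (intro exI[of _ "[a, b, c]"]) (auto simp: order_isomorphic_def All_less_Suc2)
qed

lemma contains_pattern_321: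
  "contains_pattern \<pi> [3,2,1] \<longleftrightarrow> (\<exists>a b c. subseq [a, b, c] \<pi> \<and> c < b \<and> b < a)"
proof
  assume "contains_pattern \<pi> [3,2,1]"
  then obtain xs where xs: "subseq xs \<pi>" "order_isomorphic xs [3,2,1]"
    by (auto simp: contains_pattern_def)
  then obtain a b c where "xs = [a, b, c]"
    by (auto simp: order_isomorphic_def length_Suc_conv)
  with xs show "\<exists>a b c. subseq [a, b, c] \<pi> \<and> c < b \<and> b < a"
    by (fastforce simp: order_isomorphic_def All_less_Suc2)
next
  assume "\<exists>a b c. subseq [a, b, c] \<pi> \<and> c < b \<and> b < a"
  then obtain a b c where "subseq [a, b, c] \<pi>" "c < b" "b < a"
    by blast
  then show "contains_pattern \<pi> [3,2,1]"
    unfolding contains_pattern_def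
    by (intro exI[of _ "[a, b, c]"]) (auto simp: order_isomorphic_def All_less_Suc2)
qed

lemma contains_pattern_1342:
  "contains_pattern \<pi> [1,3,4,2] \<longleftrightarrow>
    (\<exists>a b c d. subseq [a, b, c, d] \<pi> \<and> a < d \<and> d < b \<and> b < c)"
proof
  assume "contains_pattern \<pi> [1,3,4,2]"
  then obtain xs where xs: "subseq xs \<pi>" "order_isomorphic xs [1,3,4,2]"
    by (auto simp: contains_pattern_def)
  then obtain a b c d where "xs = [a, b, c, d]"
    by (auto simp: order_isomorphic_def length_Suc_conv)
  with xs show "\<exists>a b c d. subseq [a, b, c, d] \<pi> \<and> a < d \<and> d < b \<and> b < c"
    by (fastforce simp: order_isomorphic_def All_less_Suc2)
next
  assume "\<exists>a b c d. subseq [a, b, c, d] \<pi> \<and> a < d \<and> d < b \<and> b < c"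
  then obtain a b c d where "subseq [a, b, c, d] \<pi>" "a < d" "d < b" "b < c"
    by blast
  then show "contains_pattern \<pi> [1,3,4,2]"
    unfolding contains_pattern_def
    by (intro exI[of _ "[a, b, c, d]"]) (auto simp: order_isomorphic_def All_less_Suc2)
qed

lemma set_Av: "\<pi> \<in> Av n S \<Longrightarrow> set \<pi> = {1..n}"
  by (simp add: Av_def permutations_of_set_def)

text \<open>For distinct entries the order of \<open>b\<close> and \<open>c\<close> only decides
  between 312 and 321, so avoiding both forbids any entry with two smaller ones to its
  right.\<close>

lemma mem_Av_B2_iff:
  "\<pi> \<in> Av n B2 \<longleftrightarrow> (set \<pi> = {1..n} \<and> distinct \<pi>) \<and>
    \<not> (\<exists>a b c. subseq [a, b, c] \<pi> \<and> b < a \<and> c < a) \<and>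
    \<not> (\<exists>a b c d. subseq [a, b, c, d] \<pi> \<and> a < d \<and> d < b \<and> b < c)"
proof (cases "distinct \<pi>")
  case True
  have "b \<noteq> c" if "subseq [a, b, c] \<pi>" for a b c
    using subseq_distinct[OF that True] by simp
  then have "(\<exists>a b c. subseq [a, b, c] \<pi> \<and> b < a \<and> c < a) \<longleftrightarrow>
      contains_pattern \<pi> [3,1,2] \<or> contains_pattern \<pi> [3,2,1]"
    unfolding contains_pattern_312 contains_pattern_321 by (meson less_trans linorder_neqE_nat)
  then show ?thesis
    by (simp only: Av_def permutations_of_set_def B2_def contains_pattern_1342[symmetric]) auto
next
  case False
  then show ?thesis
    by (simp add: Av_def permutations_of_set_def)
qed

section \<open>The three families of avoiders\<close>

text \<open>The last letter of every pattern in \<open>B2\<close> lies below some earlier letter, so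
  a final maximum takes part in no occurrence.\<close>

lemma Av_snoc_max_iff: "\<sigma> @ [Suc m] \<in> Av (Suc m) B2 \<longleftrightarrow> \<sigma> \<in> Av m B2"
proof -
  have set: "set (\<sigma> @ [Suc m]) = {1..Suc m} \<and> distinct (\<sigma> @ [Suc m]) \<longleftrightarrow>
      set \<sigma> = {1..m} \<and> distinct \<sigma>"
    by (auto simp: atLeastAtMostSuc_conv set_eq_iff) (metis Suc_n_not_le_n)+
  show ?thesis
  proof (cases "set \<sigma> = {1..m} \<and> distinct \<sigma>")
    case True
    have le3: "a \<le> m \<and> b \<le> m \<and> c \<le> m" if "subseq [a, b, c] \<sigma>" for a b c
      using subseq_set[OF that] True by auto
    have le4: "a \<le> m \<and> b \<le> m \<and> c \<le> m \<and> d \<le> m" if "subseq [a, b, c, d] \<sigma>" for a b c d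
      using subseq_set[OF that] True by auto
    have le2: "a \<le> m \<and> b \<le> m" if "subseq [a, b] \<sigma>" for a b
      using subseq_set[OF that] True by auto
    have eq3: "subseq [a, b, c] (\<sigma> @ [Suc m]) \<and> b < a \<and> c < a \<longleftrightarrow>
        subseq [a, b, c] \<sigma> \<and> b < a \<and> c < a" for a b c
      unfolding subseq3_snoc_iff by (auto split: if_splits dest: le2 le3)
    have eq4: "subseq [a, b, c, d] (\<sigma> @ [Suc m]) \<and> a < d \<and> d < b \<and> b < c \<longleftrightarrow>
        subseq [a, b, c, d] \<sigma> \<and> a < d \<and> d < b \<and> b < c" for a b c d
      unfolding subseq4_snoc_iff by (auto split: if_splits dest: le3 le4)
    show ?thesis
      unfolding mem_Av_B2_iff eq3 eq4 set ..
  next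
    case False
    with set show ?thesis
      unfolding mem_Av_B2_iff by blast
  qed
qed

text \<open>\<open>Suc m\<close> has just one larger entry before it, while the final 2 of 1342
  needs two; \<open>Suc (Suc m)\<close> has just one entry after it, while the 3 of 312 and 321
  needs two. Hence every occurrence lies within \<open>\<sigma>\<close>.\<close>

lemma Av_snoc_swap_iff:
  "\<sigma> @ [Suc (Suc m), Suc m] \<in> Av (Suc (Suc m)) B2 \<longleftrightarrow> \<sigma> \<in> Av m B2"
proof -
  have set: "set (\<sigma> @ [Suc (Suc m), Suc m]) = {1..Suc (Suc m)} \<and>
      distinct (\<sigma> @ [Suc (Suc m), Suc m]) \<longleftrightarrow> set \<sigma> = {1..m} \<and> distinct \<sigma>"
    by (auto simp: atLeastAtMostSuc_conv set_eq_iff) (metis Suc_n_not_le_n le_SucI)+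
  have app: "\<sigma> @ [Suc (Suc m), Suc m] = (\<sigma> @ [Suc (Suc m)]) @ [Suc m]"
    by simp
  have snoc2: "subseq [a, b] (\<sigma> @ [y]) \<longleftrightarrow> (if b = y then subseq [a] \<sigma> else subseq [a, b] \<sigma>)" for a b y
    using subseq_snoc_iff[of "[a]" b \<sigma> y] by simp
  show ?thesis
  proof (cases "set \<sigma> = {1..m} \<and> distinct \<sigma>")
    case True
    have le3: "a \<le> m \<and> b \<le> m \<and> c \<le> m" if "subseq [a, b, c] \<sigma>" for a b c
      using subseq_set[OF that] True by auto
    have le4: "a \<le> m \<and> b \<le> m \<and> c \<le> m \<and> d \<le> m" if "subseq [a, b, c, d] \<sigma>" for a b c d
      using subseq_set[OF that] True by auto
    have le1: "a \<le> m" if "subseq [a] \<sigma>" for a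
      using subseq_set[OF that] True by auto
    have le2: "a \<le> m \<and> b \<le> m" if "subseq [a, b] \<sigma>" for a b
      using subseq_set[OF that] True by auto
    have eq3: "subseq [a, b, c] (\<sigma> @ [Suc (Suc m), Suc m]) \<and> b < a \<and> c < a \<longleftrightarrow>
        subseq [a, b, c] \<sigma> \<and> b < a \<and> c < a" for a b c
      unfolding app subseq3_snoc_iff snoc2 by (auto split: if_splits dest: le1 le2 le3)
    have eq4: "subseq [a, b, c, d] (\<sigma> @ [Suc (Suc m), Suc m]) \<and> a < d \<and> d < b \<and> b < c \<longleftrightarrow>
        subseq [a, b, c, d] \<sigma> \<and> a < d \<and> d < b \<and> b < c" for a b c d
      unfolding app subseq3_snoc_iff subseq4_snoc_iff snoc2 by (auto split: if_splits dest: le2 le3 le4)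
    show ?thesis
      unfolding mem_Av_B2_iff eq3 eq4 set ..
  next
    case False
    with set show ?thesis
      unfolding mem_Av_B2_iff by blast
  qed
qed

text \<open>Every inversion ends in the final 1, so no entry has two smaller ones after it. That 1
  cannot be the last letter of 1342 either, which has a smaller letter before it.\<close>

lemma rotation_mem_Av: "[2..<Suc (Suc m)] @ [1] \<in> Av (Suc m) B2"
proof -
  let ?r = "[2..<Suc (Suc m)]"
  have sorted: "sorted xs" if "subseq xs ?r" for xs
    using that by (metis sorted_nths sorted_upt subseq_conv_nths)
  have no3: False if "subseq [a, b, c] (?r @ [1])" "b < a" "c < a" for a b c
    using that sorted[of "[a, b]"] sorted[of "[a, b, c]"]
    unfolding subseq3_snoc_iff by (auto simp del: upt_Suc split: if_splits)
  have no4: False if "subseq [a, b, c, d] (?r @ [1])" "a < d" "d < b" "b < c" for a b c d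
    using that subseq_set[of "[a, b, c]" ?r] sorted[of "[a, b, c, d]"]
    unfolding subseq4_snoc_iff by (auto simp del: upt_Suc split: if_splits)
  have "set (?r @ [1]) = {1..Suc m}" "distinct (?r @ [1])"
    by auto
  with no3 no4 show ?thesis
    unfolding mem_Av_B2_iff by blast
qed

section \<open>Decomposition by the entries after the maximum\<close>

text \<open>The condition \<open>m > 0\<close> keeps the second case apart from the third: for
  \<open>m = 0\<close> both would yield \<open>[2, 1]\<close>.\<close>

lemma Av_cases:
  assumes "\<pi> \<in> Av (Suc (Suc m)) B2"
  obtains \<sigma> where "\<pi> = \<sigma> @ [Suc (Suc m)]"
  | \<sigma> where "m > 0" "\<pi> = \<sigma> @ [Suc (Suc m), Suc m]"
  | "\<pi> = [2..<Suc (Suc (Suc m))] @ [1]"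
proof -
  let ?n = "Suc (Suc m)"
  have set: "set \<pi> = {1..?n}" and dist: "distinct \<pi>"
    and no3: "\<And>a b c. subseq [a, b, c] \<pi> \<Longrightarrow> b < a \<Longrightarrow> c < a \<Longrightarrow> False"
    and no4: "\<And>a b c d. subseq [a, b, c, d] \<pi> \<Longrightarrow> a < d \<Longrightarrow> d < b \<Longrightarrow> b < c \<Longrightarrow> False"
    using assms unfolding mem_Av_B2_iff by blast+
  have "?n \<in> set \<pi>"
    using set by simp
  then obtain \<sigma> \<tau> where \<pi>: "\<pi> = \<sigma> @ ?n # \<tau>"
    by (meson split_list)
  have lt: "x < ?n" if "x \<in> set \<sigma> \<union> set \<tau>" for x
  proof -
    have "x \<in> set \<pi>" "x \<noteq> ?n"
      using that dist by (auto simp: \<pi>)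
    with set show ?thesis by simp
  qed
  consider "\<tau> = []" | x where "\<tau> = [x]" | x y \<rho> where "\<tau> = x # y # \<rho>"
    by (metis list.exhaust)
  then show ?thesis
  proof cases
    case 1
    with \<pi> that(1) show ?thesis by simp
  next
    case (3 x y \<rho>)
    \<comment> \<open>Two entries after the maximum would both be smaller than it.\<close>
    have "subseq [?n, x, y] \<pi>"
      unfolding \<pi> 3 by (intro subseq_Cons_append) simp
    then show ?thesis
      using no3 lt[of x] lt[of y] 3 by auto
  next
    case (2 x)
    have \<pi>': "\<pi> = \<sigma> @ [?n, x]"
      using \<pi> 2 by simp
    have set\<sigma>: "set \<sigma> = {1..?n} - {?n, x}" and x: "1 \<le> x" "x < ?n"
      using set dist lt[of x] 2 unfolding \<pi>' by auto
    show ?thesis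
    proof (cases "x = Suc m \<and> m > 0")
      case True
      with \<pi>' that(2) show ?thesis by simp
    next
      case False
      have "x = 1"
      proof (cases "m = 0")
        case True
        with x show ?thesis by simp
      next
        case m: False
        with False x have xm: "x < Suc m" by simp
        then have "Suc m \<in> set \<sigma>"
          using set\<sigma> by auto
        then obtain \<alpha> \<beta> where \<sigma>: "\<sigma> = \<alpha> @ Suc m # \<beta>"
          by (meson split_list)
        \<comment> \<open>An entry \<open>y\<close> between \<open>Suc m\<close> and the maximum
          would leave \<open>Suc m\<close> with two smaller entries to its right, \<open>y\<close>
          and \<open>x\<close>.\<close>
        have "\<beta> = []"
        proof (rule ccontr)
          assume "\<beta> \<noteq> []"
          then obtain y \<beta>' where \<beta>: "\<beta> = y # \<beta>'"
            by (cases \<beta>) auto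
          have "subseq [Suc m, y, x] \<pi>"
            unfolding \<pi>' \<sigma> \<beta> by (simp add: subseq_Cons_append list_emb_append2)
          moreover have "y < ?n" "y \<noteq> Suc m"
            using lt[of y] dist by (auto simp: \<sigma> \<beta> \<pi>)
          ultimately show False
            using no3 xm by (metis less_SucE)
        qed
        \<comment> \<open>Otherwise 1 stands before \<open>Suc m\<close>, and 1,
          \<open>Suc m\<close>, the maximum and \<open>x\<close> form a 1342.\<close>
        show ?thesis
        proof (rule ccontr)
          assume "x \<noteq> 1"
          with x xm m have "1 \<in> set \<sigma>" and "1 < x"
            using set\<sigma> by auto
          with xm have "1 \<in> set \<alpha>"
            by (auto simp: \<sigma> \<open>\<beta> = []\<close>)
          then have "subseq [1, Suc m, ?n, x] \<pi>"
            unfolding \<pi>' \<sigma> \<open>\<beta> = []\<close>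
            by (metis append_Cons append_assoc append_Nil list_emb_append_mono subseq_order.refl
                subseq_singleton_left)
          then show False
            using no4 \<open>1 < x\<close> xm by blast
        qed
      qed
      \<comment> \<open>A descent before the final entry 1 would complete a 321.\<close>
      have "sorted (\<sigma> @ [?n])"
      proof (rule sorted_if_subseq_le)
        fix a b assume ab: "subseq [a, b] (\<sigma> @ [?n])"
        then have "subseq [a, b, x] \<pi>"
          using list_emb_append_mono[of "(=)" "[a, b]" "\<sigma> @ [?n]" "[x]" "[x]"] by (simp add: \<pi>')
        moreover have "x < a"
        proof -
          have "a = ?n \<or> a \<in> {1..?n} - {?n, 1}"
            using subseq_set[OF ab] set\<sigma> \<open>x = 1\<close> by simp
          then have "1 < a"
            by (elim disjE) simp_all
          then show ?thesis
            using \<open>x = 1\<close> by simp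
        qed
        ultimately show "a \<le> b"
          using no3[of a b x] by (meson not_le)
      qed
      moreover have "distinct (\<sigma> @ [?n])"
        using dist by (simp add: \<pi>')
      moreover have "set (\<sigma> @ [?n]) = set [2..<Suc ?n]"
      proof -
        have "set (\<sigma> @ [?n]) = insert ?n ({1..?n} - {?n, 1})"
          using set\<sigma> \<open>x = 1\<close> by simp
        also have "\<dots> = set [2..<Suc ?n]"
          by (auto simp del: upt_Suc)
        finally show ?thesis .
      qed
      ultimately have "\<sigma> @ [?n] = [2..<Suc ?n]"
        using sorted_distinct_set_unique[of "\<sigma> @ [?n]" "[2..<Suc ?n]"] by (simp del: upt_Suc)
      then show ?thesis
        using that(3) \<pi>' \<open>x = 1\<close> by (metis append.assoc append_Cons append_Nil)
    qed
  qed
qed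

lemma Av_Suc_Suc:
  "Av (Suc (Suc m)) B2 =
    (\<lambda>\<sigma>. \<sigma> @ [Suc (Suc m)]) ` Av (Suc m) B2 \<union>
    (if m = 0 then {} else (\<lambda>\<sigma>. \<sigma> @ [Suc (Suc m), Suc m]) ` Av m B2) \<union>
    {[2..<Suc (Suc (Suc m))] @ [1]}" (is "?L = ?R")
proof
  show "?L \<subseteq> ?R"
  proof
    fix \<pi> assume \<pi>: "\<pi> \<in> ?L"
    from \<pi> show "\<pi> \<in> ?R"
    proof (cases rule: Av_cases)
      case (1 \<sigma>)
      with \<pi> show ?thesis by (simp add: Av_snoc_max_iff)
    next
      case (2 \<sigma>)
      with \<pi> show ?thesis by (simp add: Av_snoc_swap_iff)
    next
      case 3
      then show ?thesis by blast
    qed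
  qed
next
  show "?R \<subseteq> ?L"
    using rotation_mem_Av[of "Suc m"]
    by (auto simp: Av_snoc_max_iff Av_snoc_swap_iff simp del: upt_Suc)
qed

section \<open>Inversions under appending\<close>

lemma finite_inversions: "finite (inversions xs)"
  by (rule finite_subset[of _ "{..<length xs} \<times> {..<length xs}"]) (auto simp: inversions_def)

text \<open>Old pairs keep their order; each new inversion pairs an earlier, larger entry with the
  final position.\<close>

lemma card_inversions_snoc:
  "card (inversions (xs @ [x])) = card (inversions xs) + length (filter (\<lambda>y. x < y) xs)"
proof -
  have "inversions (xs @ [x]) =
      inversions xs \<union> (\<lambda>i. (i, length xs)) ` {i. i < length xs \<and> x < xs ! i}"
    by (auto simp: inversions_def nth_append split: if_splits)
  moreover have "inversions xs \<inter> (\<lambda>i. (i, length xs)) ` {i. i < length xs \<and> x < xs ! i} = {}"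
    by (auto simp: inversions_def)
  moreover have "card ((\<lambda>i. (i, length xs)) ` {i. i < length xs \<and> x < xs ! i}) =
      length (filter (\<lambda>y. x < y) xs)"
    by (simp add: card_image inj_on_def length_filter_conv_card)
  ultimately show ?thesis
    by (simp add: card_Un_disjoint finite_inversions)
qed

lemma inversions_sorted: "sorted xs \<Longrightarrow> inversions xs = {}"
  by (auto simp: inversions_def sorted_iff_nth_mono_less) (meson not_less)

text \<open>Stated for every \<open>x\<close> from \<open>m\<close> on, since in the swap
  \<open>Suc (Suc m)\<close> is appended while \<open>Suc m\<close> is still missing.\<close>

lemma card_inversions_snoc_max:
  assumes "\<sigma> \<in> Av m B2" "m \<le> x"
  shows "card (inversions (\<sigma> @ [x])) = card (inversions \<sigma>)"
proof -
  have "filter (\<lambda>y. x < y) \<sigma> = []"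
    using assms by (auto simp: filter_empty_conv dest: set_Av)
  then show ?thesis
    by (simp add: card_inversions_snoc)
qed

text \<open>The only new inversion is formed by the two appended entries.\<close>

lemma card_inversions_snoc_swap:
  assumes "\<sigma> \<in> Av m B2"
  shows "card (inversions (\<sigma> @ [Suc (Suc m), Suc m])) = Suc (card (inversions \<sigma>))"
proof -
  have "filter (\<lambda>y. Suc m < y) \<sigma> = []"
    using assms by (auto simp: filter_empty_conv dest: set_Av)
  then show ?thesis
    using card_inversions_snoc[of "\<sigma> @ [Suc (Suc m)]" "Suc m"]
      card_inversions_snoc_max[OF assms, of "Suc (Suc m)"] by simp
qed

text \<open>The \<open>m\<close> entries before the final 1 increase, and each of them exceeds
  it.\<close>

lemma card_inversions_rotation: "card (inversions ([2..<Suc (Suc m)] @ [1])) = m"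
proof -
  have "filter (\<lambda>y. 1 < y) [2..<Suc (Suc m)] = [2..<Suc (Suc m)]"
    by (auto intro: filter_True simp del: upt_Suc)
  then show ?thesis
    unfolding card_inversions_snoc by (simp add: inversions_sorted del: upt_Suc)
qed

section \<open>The counting recurrence\<close>

lemma finite_Av: "finite (Av n S)"
  by (rule finite_subset[of _ "permutations_of_set {1..n}"]) (auto simp: Av_def)

text \<open>The shift is written as \<open>Suc\<close> on the inversion count, not as
  \<open>k - 1\<close>, so that the second family contributes nothing at
  \<open>k = 0\<close>.\<close>

lemma card_Av_inversions_Suc_Suc:
  "card {\<pi> \<in> Av (Suc (Suc m)) B2. card (inversions \<pi>) = k} =
    card {\<pi> \<in> Av (Suc m) B2. card (inversions \<pi>) = k} +
    (if m = 0 then 0 else card {\<pi> \<in> Av m B2. Suc (card (inversions \<pi>)) = k}) +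
    (if k = Suc m then 1 else 0)"
proof -
  let ?f = "\<lambda>\<sigma>. \<sigma> @ [Suc (Suc m)]" and ?g = "\<lambda>\<sigma>. \<sigma> @ [Suc (Suc m), Suc m]"
  let ?r = "[2..<Suc (Suc (Suc m))] @ [1]"
  let ?A = "{\<pi> \<in> Av (Suc m) B2. card (inversions \<pi>) = k}"
  let ?B = "if m = 0 then {} else {\<pi> \<in> Av m B2. Suc (card (inversions \<pi>)) = k}"
  let ?C = "if k = Suc m then {?r} else {}"
  have "{\<pi> \<in> Av (Suc (Suc m)) B2. card (inversions \<pi>) = k} = ?f ` ?A \<union> ?g ` ?B \<union> ?C"
    unfolding Av_Suc_Suc
    using card_inversions_snoc_max[of _ "Suc m" "Suc (Suc m)"] card_inversions_snoc_swap[of _ m]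
      card_inversions_rotation[of "Suc m"]
    by (auto simp del: upt_Suc)
  \<comment> \<open>The last entries \<open>Suc (Suc m)\<close>, \<open>Suc m\<close> and 1 tell the
    families apart; the second family is present only for \<open>m > 0\<close>.\<close>
  moreover have "?f ` ?A \<inter> ?g ` ?B = {}" "(?f ` ?A \<union> ?g ` ?B) \<inter> ?C = {}"
    by (auto simp del: upt_Suc)
  moreover have "finite ?A" "finite ?B" "finite ?C"
    by (auto simp: finite_Av)
  ultimately have "card {\<pi> \<in> Av (Suc (Suc m)) B2. card (inversions \<pi>) = k} =
      card (?f ` ?A) + card (?g ` ?B) + card ?C"
    by (simp add: card_Un_disjoint del: upt_Suc)
  moreover have "card (?f ` ?A) = card ?A" "card (?g ` ?B) = card ?B"
    by (rule card_image, simp add: inj_on_def)+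
  ultimately show ?thesis
    by simp
qed

lemma Av_1: "Av 1 B2 = {[1]}"
proof -
  have "\<pi> = [1]" if "distinct \<pi>" "set \<pi> = {1 :: nat}" for \<pi>
  proof -
    have "length \<pi> = 1"
      using that distinct_card[of \<pi>] by simp
    then obtain y where "\<pi> = [y]"
      by (metis One_nat_def length_0_conv length_Suc_conv)
    then show ?thesis
      using that by simp
  qed
  \<comment> \<open>At length 1 the rotation is \<open>[1]\<close>, which gives membership.\<close>
  then show ?thesis
    using rotation_mem_Av[of 0] by (auto simp: Av_def permutations_of_set_def)
qed

section \<open>The same recurrence for the binomial sums\<close>

text \<open>The correction term reflects that a negative upper argument gives 0.\<close>

lemma int_binomial_Pascal:
  "int_binomial a b = int_binomial (a - 1) b + int_binomial (a - 1) (b - 1) +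
    (if a = 0 \<and> b = 0 then 1 else 0)"
proof (cases "1 \<le> a \<and> 1 \<le> b")
  case True
  obtain i j where "nat a = Suc i" "nat b = Suc j"
    using True by (metis Suc_nat_eq_nat_zadd1 add.commute diff_add_cancel diff_ge_0_iff_ge)
  with True have "a = int (Suc i)" "b = int (Suc j)"
    by linarith+
  then show ?thesis
    by (auto simp: int_binomial_def nat_add_distrib not_le)
next
  case False
  then show ?thesis
    by (auto simp: int_binomial_def)
qed

text \<open>Pascal's rule splits the summands into those for \<open>Suc m\<close> with
  \<open>k\<close> and those for \<open>m\<close> with \<open>k - 1\<close>, the latter taken in the
  integers so that \<open>k = 0\<close> is covered. The correction term accounts for the
  rotation.\<close>

lemma sum_int_binomial_Suc_Suc:
  "(\<Sum>l = 1..Suc (Suc m). int_binomial (int (Suc (Suc m)) - int k - 1) (int k - int l + 1)) =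
    (\<Sum>l = 1..Suc m. int_binomial (int (Suc m) - int k - 1) (int k - int l + 1)) +
    (\<Sum>l = 1..m. int_binomial (int m - (int k - 1) - 1) ((int k - 1) - int l + 1)) +
    (if k = Suc m then 1 else 0)"
proof -
  have "(\<Sum>l = 1..Suc (Suc m). int_binomial (int (Suc (Suc m)) - int k - 1) (int k - int l + 1)) =
      (\<Sum>l = 1..Suc (Suc m). int_binomial (int m - int k) (int k - int l + 1)) +
      (\<Sum>l = 1..Suc (Suc m). int_binomial (int m - int k) (int k - int l)) +
      (\<Sum>l = 1..Suc (Suc m). if int (Suc (Suc m)) - int k - 1 = 0 \<and> int k - int l + 1 = 0 then 1 else 0)"
    unfolding sum.distrib[symmetric]
    by (rule sum.cong[OF refl], subst int_binomial_Pascal) simp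
  \<comment> \<open>The correction needs \<open>k = Suc m\<close> and \<open>l = k + 1\<close>, so
    it appears in the last summand only.\<close>
  moreover have "(\<Sum>l = 1..Suc (Suc m).
      if int (Suc (Suc m)) - int k - 1 = 0 \<and> int k - int l + 1 = 0 then 1 else 0 :: nat) =
      (\<Sum>l = 1..Suc (Suc m). if l = Suc (Suc m) then (if k = Suc m then 1 else 0) else 0)"
    by (rule sum.cong) auto
  \<comment> \<open>The first sum has one surplus summand and the second has two. In each, a
    nonnegative lower argument would force \<open>k > m\<close> and hence a negative upper
    one.\<close>
  moreover have "int_binomial (int m - int k) (int k - int (Suc (Suc m)) + 1) = 0"
    "int_binomial (int m - int k) (int k - int (Suc (Suc m))) = 0"
    "int_binomial (int m - int k) (int k - int (Suc m)) = 0"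
    by (auto simp: int_binomial_def)
  ultimately show ?thesis
    by simp
qed

section \<open>Induction on the length\<close>

theorem theorem3p4:
  fixes n k :: nat
  assumes "n \<ge> 1"
  shows "card {\<pi> \<in> Av n B2. card (inversions \<pi>) = k} =
    (\<Sum>l = 1..n. int_binomial (int n - int k - 1) (int k - int l + 1))"
  using assms
\<comment> \<open>The recurrence reaches back two lengths.\<close>
proof (induction n arbitrary: k rule: induct_nat_012)
  case 0
  then show ?case by simp
next
  case 1
  have "{\<pi> \<in> Av (Suc 0) B2. card (inversions \<pi>) = k} = (if k = 0 then {[1]} else {})"
    using Av_1 inversions_sorted[of "[1]"] by (simp add: Collect_conv_if)
  \<comment> \<open>The one summand has upper argument \<open>- k\<close> and lower argument
    \<open>k\<close>, so it is 1 for \<open>k = 0\<close> and 0 otherwise.\<close>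
  then show ?case
    by (auto simp: int_binomial_def)
next
  case (ge2 m)
  have "(if m = 0 then 0 else card {\<pi> \<in> Av m B2. Suc (card (inversions \<pi>)) = k}) =
      (\<Sum>l = 1..m. int_binomial (int m - (int k - 1) - 1) ((int k - 1) - int l + 1))"
  \<comment> \<open>For \<open>k = 0\<close> every lower argument is negative. Otherwise the claim
    for \<open>m\<close> applies with \<open>k - 1\<close>, except at \<open>m = 0\<close>, where
    both sides are 0.\<close>
  proof (cases k)
    case 0
    then show ?thesis by (auto simp: int_binomial_def)
  next
    case (Suc j)
    then show ?thesis using ge2.IH(1)[of j] by auto
  qed
  then show ?case
    unfolding card_Av_inversions_Suc_Suc sum_int_binomial_Suc_Suc
    using ge2.IH(2)[of k] by simp
qed

end
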